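(* Let $p\in(0,1)$, $\nu>0$, let $d:[0,1]\to\mathbb{R}$ be strongly convex, let $D(q)=\sum_{i=1}^n d(q_i)$, and let $L=(L_1,\ldots,L_n):\mathbb{R}^d\to\mathbb{R}^n$ be differentiable. Let $$f_\nu(w)=\mathbb{S}_p^\nu(L(w)),\qquad \mathbb{S}_p^\nu(u)=\max_{q\in\Delta_p}\{q^\top u-\nu D(q)\},$$ where $\Delta_p=\{q\in\mathbb{R}^n_+:\sum_{i=1}^n q_i=1,\ q_i\le\frac1{n(1-p)}\}$. For $w\in\mathbb{R}^d$, let $\eta^\star$ be an optimal solution of the one-dimensional problem $$\min_{\eta\in\mathbb{R}}\ \eta+\sum_{i=1}^n g_\nu(L_i(w)-\eta),\qquad g_\nu(s)=\max_{0\le t\le\frac1{n(1-p)}}\{s\,t-\nu\,d(t)\}.$$ Then $$f_\nu(w)=\eta^\star+\sum_{i=1}^n g_\nu(L_i(w)-\eta^\star),\qquad \nabla f_\nu(w)=\sum_{i=1}^n g_\nu'(L_i(w)-\eta^\star)\,\nabla L_i(w).$$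
   Context: The maxima defining $g_\nu$ are understood as attained, and the segment $[0,\frac{1}{n(1-p)}]$ is understood to lie in the domain $[0,1]$ of $d$. The function $g_\nu$ is continuously differentiable and $g_\nu'(s)$ is the unique $t$ attaining the maximum in $g_\nu(s)$. Explicitly, $$g_\nu'(s)=\begin{cases}0&\text{if } s\le\nu\,d'_+(0),\\ \frac1{n(1-p)}&\text{if } s\ge\nu\, d'_-\big(\tfrac1{n(1-p)}\big),\\ (d^* )'(s/\nu)&\text{otherwise,}\end{cases}$$ where $d'_+(0)$ and $d'_-(\frac1{n(1-p)})$ are the right-derivative of $d$ at $0$ and left-derivative of $d$ at $\frac1{n(1-p)}$ (possibly infinite), and $d^*$ is the convex conjugate of $d$. *)

theory Defs
  imports "HOL-Analysis.Analysis"
begin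

definition strongly_convex_on :: "real set \<Rightarrow> (real \<Rightarrow> real) \<Rightarrow> bool" where
  "strongly_convex_on S d \<longleftrightarrow> convex S \<and>
     (\<exists>\<mu>>0. \<forall>x\<in>S. \<forall>y\<in>S. \<forall>t\<in>{0..1}.
        d ((1 - t) * x + t * y) \<le> (1 - t) * d x + t * d y - \<mu> / 2 * t * (1 - t) * (x - y)\<^sup>2)"

text \<open>An attained maximum, not a supremum: the value is unspecified if there is no maximizer.\<close>

definition max_over :: "'a set \<Rightarrow> ('a \<Rightarrow> real) \<Rightarrow> real" where
  "max_over A f = (GREATEST v. v \<in> f ` A)"

definition cap :: "nat \<Rightarrow> real \<Rightarrow> real" where
  "cap n p = 1 / (real n * (1 - p))"

definition risk_set :: "real \<Rightarrow> (real ^ 'n) set" where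
  "risk_set p = {q. (\<forall>i. 0 \<le> q $ i) \<and> (\<Sum>i\<in>UNIV. q $ i) = 1 \<and> (\<forall>i. q $ i \<le> cap CARD('n) p)}"

definition separable :: "(real \<Rightarrow> real) \<Rightarrow> real ^ 'n \<Rightarrow> real" where
  "separable d q = (\<Sum>i\<in>UNIV. d (q $ i))"

definition smoothed_superquantile ::
    "real \<Rightarrow> real \<Rightarrow> (real \<Rightarrow> real) \<Rightarrow> real ^ 'n \<Rightarrow> real" where
  "smoothed_superquantile p \<nu> d u = max_over (risk_set p) (\<lambda>q. q \<bullet> u - \<nu> * separable d q)"

definition g_smooth :: "nat \<Rightarrow> real \<Rightarrow> real \<Rightarrow> (real \<Rightarrow> real) \<Rightarrow> real \<Rightarrow> real" where
  "g_smooth n p \<nu> d s = max_over {0..cap n p} (\<lambda>t. s * t - \<nu> * d t)"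

definition dual_objective ::
    "real \<Rightarrow> real \<Rightarrow> (real \<Rightarrow> real) \<Rightarrow> real ^ 'n \<Rightarrow> real \<Rightarrow> real" where
  "dual_objective p \<nu> d u \<eta> = \<eta> + (\<Sum>i\<in>UNIV. g_smooth CARD('n) p \<nu> d (u $ i - \<eta>))"

definition gradient :: "('a::real_inner \<Rightarrow> real) \<Rightarrow> 'a \<Rightarrow> 'a" where
  "gradient f x = (THE D. GDERIV f x :> D)"

lemma gradient_eqI:
  assumes "GDERIV f x :> D"
  shows "gradient f x = D"
  unfolding gradient_def
proof (rule the_equality)
  show "GDERIV f x :> D" by (fact assms)
next
  fix D' assume "GDERIV f x :> D'"
  then have "(\<lambda>h. h \<bullet> D') = (\<lambda>h. h \<bullet> D)"
    using assms unfolding gderiv_def by (rule has_derivative_unique)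
  then have "h \<bullet> D' = h \<bullet> D" for h by meson
  then show "D' = D" using vector_eq_ldot by blast
qed

end

theory Submission
  imports Defs
begin

text \<open>
  Both maxima have the form \<open>S v = max q\<in>A. q \<bullet> v - h q\<close> with a strongly convex \<open>h\<close>, i.e. they
  are restricted convex conjugates. Strong convexity makes the objective fall off quadratically
  away from its maximizer \<open>q v\<close>; comparing the optimality of \<open>q v\<close> and \<open>q v'\<close> then shows that \<open>q\<close> is
  Lipschitz and that \<open>S v' - S v - q v \<bullet> (v' - v)\<close> lies between \<open>0\<close> and a multiple of
  \<open>\<parallel>v' - v\<parallel>\<^sup>2\<close>. So \<open>S\<close> is differentiable and its gradient is the maximizer
  (\<open>growing_maximizer.gderiv_max_over\<close>).

  Let \<open>T s\<close> be the maximizer in \<open>g_smooth\<close>, and call \<open>\<eta>\<close> balanced for \<open>u\<close> if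
  \<open>(\<Sum>i. T (u\<^sub>i - \<eta>)) = 1\<close>. Because \<open>\<Sum>i. q\<^sub>i = 1\<close> on the risk set,
  \<open>q \<bullet> u - (\<Sum>i. \<nu> * d q\<^sub>i) = \<eta> + (\<Sum>i. q\<^sub>i * (u\<^sub>i - \<eta>) - \<nu> * d q\<^sub>i)\<close> for every \<open>\<eta>\<close>, and the
  summands on the right can be maximized independently. If \<open>\<eta>\<close> is balanced, the vector of the independent maximizers belongs to the risk
  set, hence it solves the constrained problem, with no gap and with the same quadratic decay
  (\<open>risk_set_growth\<close>). A minimizer of the dual objective is balanced, since balance says that the
  derivative \<open>1 - (\<Sum>i. T (u\<^sub>i - \<eta>))\<close> vanishes.
  Differentiating at \<open>L w\<close> also requires the maximum to be attained at nearby vectors, where no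
  dual minimizer is given; there a balanced \<open>\<eta>\<close> comes from the intermediate value theorem
  (\<open>balanced_shift_exists\<close>). The chain rule through \<open>L\<close> finishes the argument.
\<close>

section \<open>Maxima with quadratic decay\<close>

lemma max_over_eqI:
  assumes "x \<in> A" and "\<And>y. y \<in> A \<Longrightarrow> f y \<le> f x"
  shows "max_over A f = f x"
  unfolding max_over_def by (rule Greatest_equality) (use assms in auto)

text \<open>The map \<open>q\<close> solves the problems \<open>max y\<in>A. y \<bullet> v - h y\<close>, parametrized by \<open>v\<close>. What survives here
  of the strong convexity of \<open>h\<close> is the decay around the maximizer, which passes from the
  scalar problem to the constrained vector problem by summation.\<close>

locale growing_maximizer =
  fixes A :: "'a::real_inner set" and h :: "'a \<Rightarrow> real" and \<kappa> :: real and q :: "'a \<Rightarrow> 'a"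
  assumes kappa_pos: "\<kappa> > 0"
    and mem: "q v \<in> A"
    and growth: "y \<in> A \<Longrightarrow> y \<bullet> v - h y + \<kappa> / 2 * (norm (y - q v))\<^sup>2 \<le> q v \<bullet> v - h (q v)"
begin

lemma maximal:
  assumes "y \<in> A"
  shows "y \<bullet> v - h y \<le> q v \<bullet> v - h (q v)"
  using growth[OF assms, of v] kappa_pos
  by (smt (verit, best) divide_nonneg_nonneg mult_nonneg_nonneg zero_le_power2)

lemma max_over_eq: "max_over A (\<lambda>y. y \<bullet> v - h y) = q v \<bullet> v - h (q v)"
  using mem maximal by (intro max_over_eqI) auto

text \<open>Adding the two decay inequalities at \<open>v\<close> and \<open>v'\<close>, each tested at the other maximizer, cancels
  the values of \<open>h\<close> and leaves strong monotonicity of \<open>q\<close>; Cauchy-Schwarz does the rest.\<close>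

lemma lipschitz: "\<kappa> * norm (q v' - q v) \<le> norm (v' - v)"
proof -
  have "\<kappa> * (norm (q v' - q v))\<^sup>2 \<le> (q v' - q v) \<bullet> (v' - v)"
    using growth[OF mem, of v v'] growth[OF mem, of v' v]
    by (simp add: inner_diff_left inner_diff_right norm_minus_commute[of "q v"])
  also have "\<dots> \<le> norm (q v' - q v) * norm (v' - v)"
    by (rule norm_cauchy_schwarz)
  finally have "norm (q v' - q v) * (\<kappa> * norm (q v' - q v)) \<le> norm (q v' - q v) * norm (v' - v)"
    by (simp add: power2_eq_square algebra_simps)
  then show ?thesis
    by (cases "q v' = q v") auto
qed

lemma continuous_maximizer: "continuous_on UNIV q"
proof (rule lipschitz_on_continuous_on)
  show "(1 / \<kappa>)-lipschitz_on UNIV q"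
    using lipschitz kappa_pos by (intro lipschitz_onI) (auto simp: dist_norm field_simps)
qed

text \<open>The envelope theorem: \<open>q v\<close> is a subgradient at \<open>v\<close> and \<open>q v'\<close> one at \<open>v'\<close>, so the linearization
  error is at most \<open>(q v' - q v) \<bullet> (v' - v)\<close>, which is of second order because \<open>q\<close> is Lipschitz.\<close>

lemma gderiv_max_over: "GDERIV (\<lambda>v. max_over A (\<lambda>y. y \<bullet> v - h y)) v :> q v"
proof -
  let ?S = "\<lambda>v. q v \<bullet> v - h (q v)"
  have error: "norm (?S v' - ?S v - (v' - v) \<bullet> q v) / norm (v' - v) \<le> norm (v' - v) / \<kappa>" for v'
  proof -
    have lower: "0 \<le> ?S v' - ?S v - (v' - v) \<bullet> q v"
      using maximal[OF mem, of v v'] by (simp add: inner_diff_right inner_diff_left inner_commute)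
    have "?S v' - ?S v - (v' - v) \<bullet> q v \<le> (q v' - q v) \<bullet> (v' - v)"
      using maximal[OF mem, of v' v] by (simp add: inner_diff_right inner_diff_left inner_commute)
    also have "\<dots> \<le> norm (q v' - q v) * norm (v' - v)"
      by (rule norm_cauchy_schwarz)
    also have "\<dots> \<le> norm (v' - v) / \<kappa> * norm (v' - v)"
      using lipschitz kappa_pos by (intro mult_right_mono) (auto simp: field_simps)
    finally show ?thesis
      using lower by (cases "v' = v") (auto simp: divide_le_eq)
  qed
  have "((\<lambda>v'. norm (v' - v) / \<kappa>) \<longlongrightarrow> norm (v - v) / \<kappa>) (at v)"
    by (intro tendsto_intros) (use kappa_pos in auto)
  then have bound: "((\<lambda>v'. norm (v' - v) / \<kappa>) \<longlongrightarrow> 0) (at v)"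
    by simp
  then have "(?S has_derivative (\<lambda>x. x \<bullet> q v)) (at v)"
    by (intro has_derivativeI_sandwich[of 1 _ _ _ _ "\<lambda>v'. norm (v' - v) / \<kappa>"])
      (use error bound in \<open>auto intro: bounded_linear_inner_left\<close>)
  then show ?thesis
    unfolding gderiv_def max_over_eq .
qed

end

section \<open>The scalar problem\<close>

text \<open>Moving from the maximizer \<open>x\<close> towards \<open>y\<close> by a fraction \<open>t\<close> does not increase the objective,
  although concavity raises it above the chord by \<open>\<nu> * \<mu> / 2 * t * (1 - t) * (x - y)\<^sup>2\<close>. Dividing by \<open>t\<close> and letting
  \<open>t\<close> tend to \<open>0\<close> bounds the slope of the chord.\<close>

lemma strongly_convex_growth:
  fixes d :: "real \<Rightarrow> real"
  assumes convex: "\<And>x y t. x \<in> A \<Longrightarrow> y \<in> A \<Longrightarrow> t \<in> {0..1} \<Longrightarrow>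
      d ((1 - t) * x + t * y) \<le> (1 - t) * d x + t * d y - \<mu> / 2 * t * (1 - t) * (x - y)\<^sup>2"
    and "convex A" and x: "x \<in> A" and y: "y \<in> A" and "\<nu> > 0"
    and max: "\<And>y. y \<in> A \<Longrightarrow> s * y - \<nu> * d y \<le> s * x - \<nu> * d x"
  shows "s * y - \<nu> * d y + \<nu> * \<mu> / 2 * (y - x)\<^sup>2 \<le> s * x - \<nu> * d x"
proof -
  let ?gap = "(s * x - \<nu> * d x) - (s * y - \<nu> * d y)"
  have bound: "\<nu> * \<mu> / 2 * (1 - t) * (x - y)\<^sup>2 \<le> ?gap" if t: "0 < t" "t < 1" for t
  proof -
    have mem: "(1 - t) * x + t * y \<in> A"
      using convexD_alt[OF \<open>convex A\<close> x y, of t] t by simp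
    have "\<nu> * d ((1 - t) * x + t * y)
        \<le> \<nu> * ((1 - t) * d x + t * d y - \<mu> / 2 * t * (1 - t) * (x - y)\<^sup>2)"
      using convex[OF x y, of t] t \<open>\<nu> > 0\<close> by (intro mult_left_mono) auto
    then have "t * (\<nu> * \<mu> / 2 * (1 - t) * (x - y)\<^sup>2) \<le> t * ?gap"
      using max[OF mem] by (simp add: algebra_simps)
    then show ?thesis
      using t by simp
  qed
  have "((\<lambda>t. \<nu> * \<mu> / 2 * (1 - t) * (x - y)\<^sup>2) \<longlongrightarrow> \<nu> * \<mu> / 2 * (1 - 0) * (x - y)\<^sup>2) (at_right 0)"
    by (intro tendsto_intros)
  moreover have "\<forall>\<^sub>F t in at_right 0. \<nu> * \<mu> / 2 * (1 - t) * (x - y)\<^sup>2 \<le> ?gap"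
    using bound unfolding eventually_at_right_field by (auto intro: exI[of _ 1])
  ultimately have "\<nu> * \<mu> / 2 * (1 - 0) * (x - y)\<^sup>2 \<le> ?gap"
    by (rule tendsto_upperbound) simp
  then show ?thesis
    by (simp add: power2_commute)
qed

lemma scalar_maximizer_exists:
  assumes "\<nu> > 0" and "strongly_convex_on {0..1} d" and "c \<le> 1"
    and attained: "\<And>s. \<exists>t. is_arg_max (\<lambda>t. s * t - \<nu> * d t) (\<lambda>t. t \<in> {0..c}) t"
  obtains \<kappa> T where "growing_maximizer {0..c} (\<lambda>t. \<nu> * d t) \<kappa> T"
proof -
  obtain \<mu> where "\<mu> > 0" and convex: "\<And>x y t. x \<in> {0..1} \<Longrightarrow> y \<in> {0..1} \<Longrightarrow> t \<in> {0..1} \<Longrightarrow>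
      d ((1 - t) * x + t * y) \<le> (1 - t) * d x + t * d y - \<mu> / 2 * t * (1 - t) * (x - y)\<^sup>2"
    using assms(2) unfolding strongly_convex_on_def by blast
  obtain T where T: "\<And>s. is_arg_max (\<lambda>t. s * t - \<nu> * d t) (\<lambda>t. t \<in> {0..c}) (T s)"
    using attained by metis
  have mem: "T s \<in> {0..c}" for s
    using T[of s] unfolding is_arg_max_def by blast
  have max: "s * y - \<nu> * d y \<le> s * T s - \<nu> * d (T s)" if "y \<in> {0..c}" for s y
    using T[of s] that unfolding is_arg_max_def by (meson not_le)
  have "growing_maximizer {0..c} (\<lambda>t. \<nu> * d t) (\<nu> * \<mu>) T"
  proof
    show "\<nu> * \<mu> > 0"
      using \<open>\<nu> > 0\<close> \<open>\<mu> > 0\<close> by simp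
    show "T s \<in> {0..c}" for s
      by (rule mem)
    show "y \<bullet> s - \<nu> * d y + \<nu> * \<mu> / 2 * (norm (y - T s))\<^sup>2 \<le> T s \<bullet> s - \<nu> * d (T s)"
      if "y \<in> {0..c}" for y s
    proof -
      have "s * y - \<nu> * d y + \<nu> * \<mu> / 2 * (y - T s)\<^sup>2 \<le> s * T s - \<nu> * d (T s)"
        by (rule strongly_convex_growth[of "{0..c}"])
          (use convex \<open>c \<le> 1\<close> mem that \<open>\<nu> > 0\<close> max in auto)
      then show ?thesis
        by (simp add: mult.commute)
    qed
  qed
  then show ?thesis
    by (rule that)
qed

section \<open>Balancing the scalar maximizers\<close>

text \<open>Since \<open>h\<close> is bounded below by its value at \<open>T 0\<close>, falling short of the right endpoint by \<open>\<delta>\<close> gains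
  at most a constant in \<open>h\<close> and costs \<open>\<delta> * s\<close>, so \<open>\<delta> = O(1/s)\<close>; likewise at the left endpoint.\<close>

lemma scalar_maximizer_tendsto_endpoints:
  fixes c :: real
  assumes "growing_maximizer {0..c} h \<kappa> T" and "0 \<le> c"
  shows "(T \<longlongrightarrow> c) at_top" and "(T \<longlongrightarrow> 0) at_bot"
proof -
  interpret growing_maximizer "{0..c}" h \<kappa> T
    by fact
  have range: "0 \<le> T s" "T s \<le> c" for s
    using mem[of s] by auto
  have h_min: "h (T 0) \<le> h (T s)" for s
    using maximal[OF mem, of s 0] by simp
  have "c - (h c - h (T 0)) / s \<le> T s" if "s > 0" for s
    using maximal[of c s] h_min[of s] that \<open>0 \<le> c\<close> by (simp add: field_simps)
  then have "\<forall>\<^sub>F s in at_top. c - (h c - h (T 0)) / s \<le> T s"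
    by (auto intro: eventually_mono[OF eventually_gt_at_top[of 0]])
  moreover have "((\<lambda>s. c - (h c - h (T 0)) / s) \<longlongrightarrow> c - 0) at_top"
    by (intro tendsto_intros tendsto_divide_0[OF tendsto_const]
        filterlim_at_top_imp_at_infinity filterlim_ident)
  ultimately show "(T \<longlongrightarrow> c) at_top"
    using tendsto_sandwich[of "\<lambda>s. c - (h c - h (T 0)) / s" T at_top "\<lambda>_. c" c] range by simp
  have "T s \<le> (h (T 0) - h 0) / s" if "s < 0" for s
    using maximal[of 0 s] h_min[of s] that \<open>0 \<le> c\<close> by (simp add: field_simps)
  then have "\<forall>\<^sub>F s in at_bot. T s \<le> (h (T 0) - h 0) / s"
    by (auto intro: eventually_mono[OF eventually_gt_at_bot[of 0]])
  moreover have "((\<lambda>s. (h (T 0) - h 0) / s) \<longlongrightarrow> 0) at_bot"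
    by (intro tendsto_divide_0[OF tendsto_const] filterlim_at_bot_imp_at_infinity filterlim_ident)
  ultimately show "(T \<longlongrightarrow> 0) at_bot"
    using tendsto_sandwich[of "\<lambda>_. 0" T at_bot "\<lambda>s. (h (T 0) - h 0) / s" 0] range by simp
qed

text \<open>As \<open>\<eta>\<close> runs from \<open>-\<infinity>\<close> to \<open>\<infinity>\<close>, the sum falls continuously from \<open>n c > 1\<close> to \<open>0\<close>.\<close>

lemma balanced_shift_exists:
  fixes u :: "real ^ 'n"
  assumes "growing_maximizer {0..c} h \<kappa> T" and "0 \<le> c" and "real CARD('n) * c > 1"
  shows "\<exists>\<eta>. (\<Sum>i\<in>UNIV. T (u $ i - \<eta>)) = 1"
proof -
  let ?F = "\<lambda>\<eta>. \<Sum>i\<in>UNIV. T (u $ i - \<eta>)"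
  interpret growing_maximizer "{0..c}" h \<kappa> T
    by fact
  note limits = scalar_maximizer_tendsto_endpoints[OF assms(1,2)]
  have to_top: "filterlim (\<lambda>\<eta>. u $ i - \<eta>) at_top at_bot" for i
    unfolding diff_conv_add_uminus
    by (intro filterlim_tendsto_add_at_top[OF tendsto_const] filterlim_uminus_at_top_at_bot)
  have to_bot: "filterlim (\<lambda>\<eta>. u $ i - \<eta>) at_bot at_top" for i
  proof -
    have "filterlim (\<lambda>\<eta>. - (- u $ i + \<eta>)) at_bot at_top"
      by (intro filterlim_uminus_at_top[THEN iffD1]
          filterlim_tendsto_add_at_top[OF tendsto_const filterlim_ident])
    then show ?thesis
      by simp
  qed
  have "(?F \<longlongrightarrow> (\<Sum>i\<in>(UNIV :: 'n set). c)) at_bot"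
    by (intro tendsto_sum filterlim_compose[OF limits(1) to_top])
  then have "\<forall>\<^sub>F \<eta> in at_bot. 1 < ?F \<eta>"
    by (rule order_tendstoD) (use assms(3) in simp)
  then obtain a where a: "a \<le> 0" "1 < ?F a"
    using eventually_happens'[OF _ eventually_conj[OF _ eventually_le_at_bot[of 0]]]
    by (metis (no_types, lifting) trivial_limit_at_bot_linorder)
  have "(?F \<longlongrightarrow> (\<Sum>i\<in>(UNIV :: 'n set). 0)) at_top"
    by (intro tendsto_sum filterlim_compose[OF limits(2) to_bot])
  then have "\<forall>\<^sub>F \<eta> in at_top. ?F \<eta> < 1"
    by (rule order_tendstoD) simp
  then obtain b where b: "0 \<le> b" "?F b < 1"
    using eventually_happens'[OF _ eventually_conj[OF _ eventually_ge_at_top[of 0]]]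
    by (metis (no_types, lifting) trivial_limit_at_top_linorder)
  have "continuous_on {a..b} ?F"
    by (intro continuous_intros continuous_on_compose2[OF continuous_maximizer]) auto
  then show ?thesis
    using IVT2'[of ?F b 1 a] a b by auto
qed

section \<open>From the scalar problem to the risk set\<close>

lemma risk_set_inner_shift:
  assumes "q \<in> risk_set p"
  shows "q \<bullet> u - separable h q = \<eta> + (\<Sum>i\<in>UNIV. q $ i * (u $ i - \<eta>) - h (q $ i))"
proof -
  have "(\<Sum>i\<in>UNIV. q $ i * \<eta>) = \<eta>"
    using assms by (simp add: risk_set_def flip: sum_distrib_right)
  then show ?thesis
    by (simp add: inner_vec_def separable_def right_diff_distrib sum_subtractf)
qed

text \<open>The normalization \<open>\<Sum>i. q\<^sub>i = 1\<close> is the only constraint that couples the coordinates; shifting \<open>u\<close> by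
  its multiplier \<open>\<eta>\<close> leaves independent scalar problems, and their decay inequalities add up
  because \<open>\<parallel>y - q\<parallel>\<^sup>2\<close> is the sum of the squared coordinate differences.\<close>

lemma risk_set_growth:
  fixes E :: "real ^ 'n \<Rightarrow> real"
  assumes T: "growing_maximizer {0..cap CARD('n) p} h \<kappa> T"
    and balanced: "\<And>u. (\<Sum>i\<in>UNIV. T (u $ i - E u)) = 1"
  shows "growing_maximizer (risk_set p) (separable h) \<kappa> (\<lambda>u. \<chi> i. T (u $ i - E u))"
proof
  interpret growing_maximizer "{0..cap CARD('n) p}" h \<kappa> T
    by fact
  show "\<kappa> > 0"
    by (rule kappa_pos)
  let ?q = "\<lambda>u :: real ^ 'n. \<chi> i. T (u $ i - E u)"
  show q_mem: "?q u \<in> risk_set p" for u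
    using mem balanced by (auto simp: risk_set_def)
  show "y \<bullet> u - separable h y + \<kappa> / 2 * (norm (y - ?q u))\<^sup>2 \<le> ?q u \<bullet> u - separable h (?q u)"
    if y: "y \<in> risk_set p" for y u
  proof -
    have "(norm (y - ?q u))\<^sup>2 = (\<Sum>i\<in>UNIV. (y $ i - ?q u $ i)\<^sup>2)"
      unfolding power2_norm_eq_inner inner_vec_def by (simp add: power2_eq_square)
    then have "y \<bullet> u - separable h y + \<kappa> / 2 * (norm (y - ?q u))\<^sup>2
        = E u + (\<Sum>i\<in>UNIV. y $ i * (u $ i - E u) - h (y $ i) + \<kappa> / 2 * (y $ i - ?q u $ i)\<^sup>2)"
      unfolding risk_set_inner_shift[OF y, where \<eta> = "E u"]
      by (simp add: sum.distrib sum_distrib_left)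
    also have "\<dots> \<le> E u + (\<Sum>i\<in>UNIV. ?q u $ i * (u $ i - E u) - h (?q u $ i))"
      using growth y by (intro add_left_mono sum_mono) (auto simp: risk_set_def)
    also have "\<dots> = ?q u \<bullet> u - separable h (?q u)"
      by (rule risk_set_inner_shift[OF q_mem, symmetric])
    finally show ?thesis .
  qed
qed

section \<open>Dual minimizers and the chain rule\<close>

lemma g_smooth_has_derivative:
  assumes "growing_maximizer {0..cap n p} (\<lambda>t. \<nu> * d t) \<kappa> T"
  shows "(g_smooth n p \<nu> d has_real_derivative T s) (at s)"
proof -
  have "g_smooth n p \<nu> d = (\<lambda>s. max_over {0..cap n p} (\<lambda>t. t \<bullet> s - \<nu> * d t))"
    by (simp add: g_smooth_def fun_eq_iff mult.commute)
  then show ?thesis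
    using growing_maximizer.gderiv_max_over[OF assms, of s]
    by (simp add: gderiv_def has_field_derivative_def mult.commute[of "T s"])
qed

lemma dual_minimizer_balanced:
  fixes u :: "real ^ 'n"
  assumes T: "growing_maximizer {0..cap CARD('n) p} (\<lambda>t. \<nu> * d t) \<kappa> T"
    and min: "is_arg_min (dual_objective p \<nu> d u) (\<lambda>_. True) \<eta>"
  shows "(\<Sum>i\<in>UNIV. T (u $ i - \<eta>)) = 1"
proof -
  note deriv_g = DERIV_chain2[OF g_smooth_has_derivative[OF T]]
  have "(dual_objective p \<nu> d u has_real_derivative 1 + (\<Sum>i\<in>UNIV. T (u $ i - \<eta>) * (0 - 1))) (at \<eta>)"
    unfolding dual_objective_def[abs_def] by (intro derivative_intros deriv_g)
  moreover have "\<forall>y. \<bar>\<eta> - y\<bar> < 1 \<longrightarrow> dual_objective p \<nu> d u \<eta> \<le> dual_objective p \<nu> d u y"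
    using min unfolding is_arg_min_def by (metis not_le)
  ultimately have "1 + (\<Sum>i\<in>UNIV. T (u $ i - \<eta>) * (0 - 1)) = 0"
    by (rule DERIV_local_min[OF _ zero_less_one])
  then show ?thesis
    by (simp add: sum_negf)
qed

lemma gderiv_compose_vec:
  fixes F :: "real ^ 'n \<Rightarrow> real" and L :: "'a::euclidean_space \<Rightarrow> real ^ 'n"
  assumes F: "GDERIV F (L w) :> q" and "L differentiable (at w)"
  shows "GDERIV (\<lambda>v. F (L v)) w :> (\<Sum>i\<in>UNIV. q $ i *\<^sub>R gradient (\<lambda>v. L v $ i) w)"
proof -
  obtain L' where L': "(L has_derivative L') (at w)"
    using assms(2) unfolding differentiable_def by blast
  then have "linear L'"
    by (rule has_derivative_linear)
  have "((\<lambda>v. L v $ i) has_derivative (\<lambda>x. x \<bullet> adjoint L' (axis i 1))) (at w)" for i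
    using bounded_linear.has_derivative[OF bounded_linear_vec_nth[of i] L']
    by (simp add: adjoint_works[OF \<open>linear L'\<close>] inner_axis)
  then have grad: "gradient (\<lambda>v. L v $ i) w = adjoint L' (axis i 1)" for i
    by (intro gradient_eqI) (simp add: gderiv_def)
  have "L' x \<bullet> q = x \<bullet> (\<Sum>i\<in>UNIV. q $ i *\<^sub>R adjoint L' (axis i 1))" for x
    by (simp add: inner_vec_def[of "L' x"] inner_sum_right adjoint_works[OF \<open>linear L'\<close>]
        inner_axis mult.commute)
  then show ?thesis
    using has_derivative_compose[OF L' F[unfolded gderiv_def]]
    by (simp add: gderiv_def grad)
qed


theorem corollary5:
  fixes p \<nu> :: real
    and d :: "real \<Rightarrow> real"
    and L :: "real ^ 'm \<Rightarrow> real ^ 'n"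
    and w :: "real ^ 'm"
    and \<eta> :: real
  assumes "0 < p" and "p < 1"
    and "\<nu> > 0"
    and "strongly_convex_on {0..1} d"
    and "cap CARD('n) p \<le> 1"
    and "\<And>s. \<exists>t. is_arg_max (\<lambda>t. s * t - \<nu> * d t) (\<lambda>t. t \<in> {0..cap CARD('n) p}) t"
    and "\<And>x. L differentiable (at x)"
    and "is_arg_min (dual_objective p \<nu> d (L w)) (\<lambda>_. True) \<eta>"
  shows "smoothed_superquantile p \<nu> d (L w)
           = \<eta> + (\<Sum>i\<in>UNIV. g_smooth CARD('n) p \<nu> d (L w $ i - \<eta>))
    \<and> GDERIV (\<lambda>v. smoothed_superquantile p \<nu> d (L v)) w :>
           (\<Sum>i\<in>UNIV. deriv (g_smooth CARD('n) p \<nu> d) (L w $ i - \<eta>)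
                        *\<^sub>R gradient (\<lambda>v. L v $ i) w)"
proof -
  have cap: "0 \<le> cap CARD('n) p" "real CARD('n) * cap CARD('n) p > 1"
    using \<open>0 < p\<close> \<open>p < 1\<close> by (auto simp: cap_def)
  obtain \<kappa> T where T: "growing_maximizer {0..cap CARD('n) p} (\<lambda>t. \<nu> * d t) \<kappa> T"
    using scalar_maximizer_exists assms(3-6) by blast
  \<comment> \<open>Differentiating at \<open>L w\<close> requires a balanced shift for every vector; at \<open>L w\<close> itself
    the given \<open>\<eta>\<close> is chosen, so that the gradient there is expressed through it.\<close>
  have "\<exists>E. E (L w) = \<eta> \<and> (\<forall>u :: real ^ 'n. (\<Sum>i\<in>UNIV. T (u $ i - E u)) = 1)"
  proof -
    obtain E where "\<And>u :: real ^ 'n. (\<Sum>i\<in>UNIV. T (u $ i - E u)) = 1"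
      using balanced_shift_exists[OF T cap] by metis
    then show ?thesis
      using dual_minimizer_balanced[OF T assms(8)] by (intro exI[of _ "E(L w := \<eta>)"]) auto
  qed
  then obtain E where E: "E (L w) = \<eta>" "\<And>u :: real ^ 'n. (\<Sum>i\<in>UNIV. T (u $ i - E u)) = 1"
    by blast
  define q where "q = (\<lambda>u :: real ^ 'n. \<chi> i. T (u $ i - E u))"
  interpret scalar: growing_maximizer "{0..cap CARD('n) p}" "\<lambda>t. \<nu> * d t" \<kappa> T
    by (rule T)
  interpret vector: growing_maximizer "risk_set p" "separable (\<lambda>t. \<nu> * d t)" \<kappa> q
    unfolding q_def by (rule risk_set_growth[OF T E(2)])
  have S: "smoothed_superquantile p \<nu> d
      = (\<lambda>u :: real ^ 'n. max_over (risk_set p) (\<lambda>y. y \<bullet> u - separable (\<lambda>t. \<nu> * d t) y))"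
    by (simp add: smoothed_superquantile_def separable_def sum_distrib_left fun_eq_iff)
  have g: "g_smooth CARD('n) p \<nu> d s = T s * s - \<nu> * d (T s)" for s
    using scalar.max_over_eq[of s] by (simp add: g_smooth_def mult.commute)
  have "smoothed_superquantile p \<nu> d (L w)
      = \<eta> + (\<Sum>i\<in>UNIV. g_smooth CARD('n) p \<nu> d (L w $ i - \<eta>))"
    unfolding S vector.max_over_eq risk_set_inner_shift[OF vector.mem, where \<eta> = \<eta>]
    by (simp add: q_def E(1) g)
  moreover have "deriv (g_smooth CARD('n) p \<nu> d) (L w $ i - \<eta>) = q (L w) $ i" for i
    using DERIV_imp_deriv[OF g_smooth_has_derivative[OF T]] by (simp add: q_def E(1))
  moreover have "GDERIV (\<lambda>v. smoothed_superquantile p \<nu> d (L v)) w :>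
      (\<Sum>i\<in>UNIV. q (L w) $ i *\<^sub>R gradient (\<lambda>v. L v $ i) w)"
    by (rule gderiv_compose_vec[OF _ assms(7)]) (simp add: S vector.gderiv_max_over)
  ultimately show ?thesis
    by simp
qed

end
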